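(* Let $m\geq 1$ be an integer, let $\beta\in(0,1)$ be a real number satisfying $\beta^2+m\beta=1$, and let $(G_n)_{n\geq 0}$ be the integer sequence defined by $G_0=0$, $G_1=1$, $G_{n+2}=mG_{n+1}+G_n$ for $n\geq 0$. Let $i\geq 1$ be an integer. For $j\in\mathbb{Z}$ define the integer $\varepsilon_i(j)$ by $$\bigl\lfloor \beta(j+G_i)\bigr\rfloor = \lfloor \beta j\rfloor + G_{i-1} + \varepsilon_i(j).$$ Then for every $j\in\mathbb{Z}$ we have $\varepsilon_i(j)\in\bigl\{0,(-1)^{i+1}\bigr\}$. Moreover, the frequency of integers $j$ for which $\varepsilon_i(j)$ is non-zero exists and equals $\beta^i$, that is, $$\lim_{n\to\infty}\frac{\#\{j\in\mathbb{Z}\mid -n\leq j\leq n,\ \varepsilon_i(j)\neq 0\}}{2n+1}=\beta^i.$$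
   Context: $\lfloor x\rfloor$ denotes the greatest integer not exceeding the real number $x$. *)

theory Defs
  imports Complex_Main
begin

fun G :: "int \<Rightarrow> nat \<Rightarrow> int" where
  "G m 0 = 0"
| "G m (Suc 0) = 1"
| "G m (Suc (Suc n)) = m * G m (Suc n) + G m n"

(* The defining equation
     floor (beta * (j + G_i)) = floor (beta * j) + G_(i-1) + eps
   solved for eps; only meant for i >= 1, as i - 1 is truncated on nat. *)
definition eps :: "int \<Rightarrow> real \<Rightarrow> nat \<Rightarrow> int \<Rightarrow> int" where
  "eps m \<beta> i j =
     \<lfloor>\<beta> * real_of_int (j + G m i)\<rfloor> - \<lfloor>\<beta> * real_of_int j\<rfloor> - G m (i - 1)"

end

theory Submission
  imports Defs
begin

text \<open>Since \<open>\<beta> * G\<^sub>i = G\<^sub>i\<^sub>-\<^sub>1 - (- \<beta>)^i\<close>, the error term is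
  \<open>\<epsilon>\<^sub>i(j) = frac (\<beta> * j) - frac (\<beta> * (j + G\<^sub>i)) - (- \<beta>)^i\<close>. It lies within distance less than 1
  of \<open>- (- \<beta>)^i\<close>, which leaves the two possible values. Summed over a symmetric interval, the two
  fractional parts telescope up to at most \<open>G\<^sub>i\<close>, so the frequency needs no equidistribution
  argument.\<close>

lemma G_nonneg:
  assumes "m \<ge> 0"
  shows "G m n \<ge> 0"
  using assms by (induction m n rule: G.induct) auto

text \<open>By the equation for \<open>\<beta>\<close>, \<open>- \<beta>\<close> is a root of
  \<open>x^2 = m * x + 1\<close>, the characteristic equation of \<open>G\<close>. So powers of
  \<open>- \<beta>\<close> obey the same recurrence as \<open>G\<close>, and it suffices to compare
  two initial values.\<close>

lemma beta_times_G:
  fixes \<beta> :: real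
  assumes "\<beta>^2 + real_of_int m * \<beta> = 1"
  shows "\<beta> * real_of_int (G m (Suc n)) = real_of_int (G m n) - (- \<beta>) ^ Suc n"
proof (induction n rule: induct_nat_012)
  case 1
  show ?case using assms by (simp add: power2_eq_square algebra_simps)
next
  case (ge2 n)
  have "\<beta> * real_of_int (G m (Suc (Suc (Suc n))))
      = real_of_int m * (\<beta> * real_of_int (G m (Suc (Suc n)))) + \<beta> * real_of_int (G m (Suc n))"
    by (simp add: algebra_simps)
  also have "\<dots> = real_of_int (G m (Suc (Suc n)))
      - (- \<beta>) ^ Suc n * (1 - real_of_int m * \<beta>)"
    unfolding ge2 by (simp add: algebra_simps)
  also have "1 - real_of_int m * \<beta> = (- \<beta>)^2"
    using assms by simp
  finally show ?case
    by (simp add: power2_eq_square)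
qed auto

lemma eps_eq_frac:
  fixes \<beta> :: real
  assumes "\<beta>^2 + real_of_int m * \<beta> = 1" and "i \<ge> 1"
  shows "real_of_int (eps m \<beta> i j) =
    frac (\<beta> * real_of_int j) - frac (\<beta> * real_of_int (j + G m i)) - (- \<beta>) ^ i"
proof -
  obtain n where "i = Suc n" using assms(2) by (cases i) auto
  then show ?thesis
    using beta_times_G[OF assms(1), of n] by (simp add: eps_def frac_def algebra_simps)
qed

lemma sum_telescope_symmetric_int:
  fixes f :: "int \<Rightarrow> 'a::ab_group_add"
  shows "(\<Sum>j\<in>{- int n..int n}. f j - f (j + 1)) = f (- int n) - f (int n + 1)"
proof (induction n)
  case (Suc n)
  have "{- int (Suc n)..int (Suc n)} = insert (- 1 - int n) (insert (int n + 1) {- int n..int n})"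
    by auto
  then show ?case using Suc by (simp add: algebra_simps)
qed simp

text \<open>Increasing the shift by one changes the sum only by a difference of two boundary values
  of \<open>f\<close>, hence by at most 1. The bound does not depend on \<open>n\<close>, so it
  vanishes after division by the length of the interval.\<close>

lemma abs_sum_shift_le:
  fixes f :: "int \<Rightarrow> real"
  assumes "\<And>j. 0 \<le> f j" and "\<And>j. f j \<le> 1"
  shows "\<bar>\<Sum>j\<in>{- int n..int n}. f j - f (j + int k)\<bar> \<le> real k"
proof (induction k)
  case (Suc k)
  have "(\<Sum>j\<in>{- int n..int n}. f j - f (j + int (Suc k)))
      = (\<Sum>j\<in>{- int n..int n}. f j - f (j + int k))
        + (\<Sum>j\<in>{- int n..int n}. f (j + int k) - f (j + 1 + int k))"
    by (simp add: sum.distrib[symmetric] algebra_simps)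
  also have "(\<Sum>j\<in>{- int n..int n}. f (j + int k) - f (j + 1 + int k))
      = f (- int n + int k) - f (int n + 1 + int k)"
    by (rule sum_telescope_symmetric_int)
  finally show ?case
    using Suc assms(1,2)[of "- int n + int k"] assms(1,2)[of "int n + 1 + int k"]
    by linarith
qed simp

lemma eps_cases:
  fixes \<beta> :: real
  assumes "0 < \<beta>" and "\<beta> < 1" and "\<beta>^2 + real_of_int m * \<beta> = 1" and "i \<ge> 1"
  shows "eps m \<beta> i j \<in> {0, (-1) ^ (i + 1)}"
proof -
  have pow: "0 < \<beta> ^ i" "\<beta> ^ i < 1"
    using assms by (simp_all add: power_less_one_iff)
  define x where "x = frac (\<beta> * real_of_int j)"
  define y where "y = frac (\<beta> * real_of_int (j + G m i))"
  have xy: "0 \<le> x" "x < 1" "0 \<le> y" "y < 1"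
    by (simp_all add: x_def y_def frac_lt_1)
  have e: "real_of_int (eps m \<beta> i j) = x - y - (- \<beta>) ^ i"
    using eps_eq_frac[OF assms(3,4)] by (simp add: x_def y_def)
  show ?thesis
  \<comment> \<open>The parity of \<open>i\<close> fixes the sign of \<open>(- \<beta>) ^ i\<close>.
    Since \<open>x - y\<close> lies strictly between -1 and 1, the even case leaves only the
    integers -1 and 0, the odd case only 0 and 1.\<close>
  proof (cases "even i")
    case True
    then have "-2 < real_of_int (eps m \<beta> i j)" "real_of_int (eps m \<beta> i j) < 1"
      using e xy pow by simp_all
    with True show ?thesis by auto
  next
    case False
    then have "-1 < real_of_int (eps m \<beta> i j)" "real_of_int (eps m \<beta> i j) < 2"
      using e xy pow by simp_all
    with False show ?thesis by auto
  qed
qed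

theorem theorem1:
  fixes m :: int and \<beta> :: real and i :: nat
  assumes "m \<ge> 1"
    and "0 < \<beta>" and "\<beta> < 1"
    and "\<beta>^2 + real_of_int m * \<beta> = 1"
    and "i \<ge> 1"
  shows "(\<forall>j::int. eps m \<beta> i j \<in> {0, (-1) ^ (i + 1)}) \<and>
    (\<lambda>n::nat. real (card {j::int. - int n \<le> j \<and> j \<le> int n \<and> eps m \<beta> i j \<noteq> 0})
                / (2 * real n + 1)) \<longlonglongrightarrow> \<beta> ^ i"
proof
  show eps: "\<forall>j::int. eps m \<beta> i j \<in> {0, (-1) ^ (i + 1)}"
    using eps_cases[OF assms(2-5)] by blast
  define S where "S n = {j::int. - int n \<le> j \<and> j \<le> int n \<and> eps m \<beta> i j \<noteq> 0}" for n
  \<comment> \<open>The shift is turned into a natural number because the telescoping bound is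
    proved by induction on it.\<close>
  define k where "k = nat (G m i)"
  have k: "G m i = int k"
    using G_nonneg[of m i] assms(1) by (simp add: k_def)
  define f where "f j = frac (\<beta> * real_of_int j)" for j
  have bound: "\<bar>real (card (S n)) / (2 * real n + 1) - \<beta> ^ i\<bar> \<le> real k / (2 * real n + 1)" for n
  proof -
    have ind: "(if eps m \<beta> i j \<noteq> 0 then 1 else 0)
        = (-1) ^ (i + 1) * (f j - f (j + int k)) + \<beta> ^ i" for j
    proof -
      \<comment> \<open>The only possible non-zero value is \<open>(-1) ^ (i + 1)\<close>, so
        multiplying by this same sign turns \<open>eps\<close> into its own indicator. It also turns
        the constant term \<open>- (- \<beta>) ^ i\<close> into \<open>\<beta> ^ i\<close>, the
        claimed frequency.\<close>
      have "(if eps m \<beta> i j \<noteq> 0 then 1 else 0)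
          = (-1) ^ (i + 1) * real_of_int (eps m \<beta> i j)"
        using eps[rule_format, of j] by (auto simp flip: power_mult_distrib)
      also have "\<dots> = (-1) ^ (i + 1) * (f j - f (j + int k))
          + (-1) ^ i * (- \<beta>) ^ i"
        unfolding eps_eq_frac[OF assms(4,5)] k f_def by (simp add: algebra_simps)
      finally show ?thesis
        by (simp flip: power_mult_distrib)
    qed
    have "S n = {j \<in> {- int n..int n}. eps m \<beta> i j \<noteq> 0}"
      by (auto simp: S_def)
    then have "real (card (S n)) = (\<Sum>j\<in>{- int n..int n}. if eps m \<beta> i j \<noteq> 0 then 1 else 0)"
      by (simp add: sum.If_cases Int_def)
    \<comment> \<open>The factor \<open>2 * real n + 1\<close> counts the integers of the interval,
      each contributing \<open>\<beta> ^ i\<close>.\<close>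
    also have "\<dots> = (-1) ^ (i + 1) * (\<Sum>j\<in>{- int n..int n}. f j - f (j + int k))
        + (2 * real n + 1) * \<beta> ^ i"
      unfolding ind sum.distrib sum_distrib_left[symmetric] by simp
    finally have "\<bar>real (card (S n)) - (2 * real n + 1) * \<beta> ^ i\<bar> \<le> real k"
      using abs_sum_shift_le[where f = f and n = n and k = k]
      by (simp add: f_def abs_mult power_abs less_imp_le[OF frac_lt_1])
    moreover have "real (card (S n)) / (2 * real n + 1) - \<beta> ^ i
        = (real (card (S n)) - (2 * real n + 1) * \<beta> ^ i) / (2 * real n + 1)"
      by (simp add: field_simps)
    ultimately show ?thesis
      by (simp add: abs_divide divide_right_mono)
  qed
  have "filterlim (\<lambda>n. 2 * real n + 1) at_top sequentially"
    by (rule filterlim_at_top_mono[OF filterlim_real_sequentially]) simp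
  then have "(\<lambda>n. real k / (2 * real n + 1)) \<longlonglongrightarrow> 0"
    by (intro tendsto_divide_0[OF tendsto_const] filterlim_at_top_imp_at_infinity)
  then have "(\<lambda>n. real (card (S n)) / (2 * real n + 1) - \<beta> ^ i) \<longlonglongrightarrow> 0"
    by (rule tendsto_0_le[where K = 1]) (simp add: bound)
  then show "(\<lambda>n::nat. real (card {j::int. - int n \<le> j \<and> j \<le> int n \<and> eps m \<beta> i j \<noteq> 0})
                / (2 * real n + 1)) \<longlonglongrightarrow> \<beta> ^ i"
    by (simp add: S_def LIM_zero_iff)
qed

end
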